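(* Let $E$ be a nonzero real Banach space. Then $\{(x^*, \widehat{x}) : x \in E,\ x^* \in E^*\}$ is quasidense in $E^* \times E^{**}$. In other words, for all $(y^*, y^{**}) \in E^* \times E^{**}$, $$\inf_{(x,x^* ) \in E \times E^*}\Big[\tfrac12\|y^* - x^*\|^2 + \tfrac12\|y^{**} - \widehat{x}\|^2 + \langle y^* - x^*, y^{**} - \widehat{x}\rangle\Big] = 0.$$
   Context: $E^*$ and $E^{**}$ are the dual and bidual of $E$, with pairings $\langle x, x^*\rangle$ ($x \in E$, $x^* \in E^*$) and $\langle x^*, x^{**}\rangle$ ($x^* \in E^*$, $x^{**} \in E^{**}$); $\widehat{x}$ denotes the canonical image of $x \in E$ in $E^{**}$. For a nonzero real Banach space $F$, a subset $A \subset F \times F^*$ is quasidense (in $F \times F^*$) if, for all $(x,x^* ) \in F \times F^*$, $\inf_{(s,s^* ) \in A}\big[\frac12\|s-x\|^2 + \frac12\|s^*-x^*\|^2 + \langle s-x, s^*-x^*\rangle\big] \le 0$ (equivalently $=0$, the bracket being always $\ge 0$). Here this is applied with $F = E^*$, $F^* = E^{**}$. *)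

theory Defs
  imports "HOL-Analysis.Analysis"
begin

type_synonym 'a dual = "'a \<Rightarrow>\<^sub>L real"

definition canonical_embedding :: "'a::real_normed_vector \<Rightarrow> 'a dual dual" where
  "canonical_embedding x = Blinfun (\<lambda>f. blinfun_apply f x)"

lemma blinfun_apply_canonical_embedding [simp]:
  "blinfun_apply (canonical_embedding x) f = blinfun_apply f x"
  unfolding canonical_embedding_def
  by (simp add: bounded_linear_Blinfun_apply blinfun.bounded_linear_left)

(* The infimum is taken in the extended reals, so that the infimum over the empty set is
   +infinity and the empty set is not quasidense. *)
definition quasidense :: "('f::banach \<times> 'f dual) set \<Rightarrow> bool" where
  "quasidense A \<longleftrightarrow> (\<forall>x x'.
     (INF (s, s') \<in> A. ereal (1/2 * (norm (s - x))\<^sup>2 + 1/2 * (norm (s' - x'))\<^sup>2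
                          + blinfun_apply (s' - x') (s - x))) \<le> 0)"

end

theory Submission imports Defs begin

text \<open>
  The first coordinate of the given set runs through the whole space \<open>F = E\<^sup>*\<close>, and this alone
  makes the set quasidense: the infimum over any slice
  \<open>F \<times> {t}\<close> is already zero. Once the second coordinate is fixed, with difference \<open>w\<close>, the bracket
  \<open>\<parallel>z\<parallel>\<^sup>2/2 + \<parallel>w\<parallel>\<^sup>2/2 + w z\<close> is minimised over a free vector \<open>z\<close>. The definition of the operator norm
  provides \<open>z\<close> with \<open>\<parallel>z\<parallel> = \<parallel>w\<parallel>\<close> and \<open>w z\<close> as close to \<open>-\<parallel>w\<parallel>\<^sup>2\<close> as desired
  (lemma \<open>quasidense_bracket_small\<close>), so that the bracket is arbitrarily small; it is never
  negative because \<open>w z \<ge> -\<parallel>w\<parallel> \<parallel>z\<parallel>\<close> (lemma \<open>quasidense_bracket_nonneg\<close>). The second form of the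
  theorem differs from the first only in the sign of both differences, under which the bracket is
  invariant.
\<close>

lemma quasidense_bracket_nonneg:
  fixes w :: "'f::real_normed_vector dual"
  shows "0 \<le> 1/2 * (norm z)\<^sup>2 + 1/2 * (norm w)\<^sup>2 + blinfun_apply w z"
proof -
  have "\<bar>blinfun_apply w z\<bar> \<le> norm w * norm z"
    using norm_blinfun[of w z] by simp
  moreover have "2 * (norm w * norm z) \<le> (norm z)\<^sup>2 + (norm w)\<^sup>2"
    using sum_squares_bound[of "norm w" "norm z"] by simp
  ultimately show ?thesis
    by linarith
qed

text \<open>
  Almost norming vectors exist for every bounded functional; rescaling one to the length of
  the functional, with the sign that makes its value negative, turns the three terms into nearly
  \<open>\<parallel>w\<parallel>\<^sup>2/2 + \<parallel>w\<parallel>\<^sup>2/2 - \<parallel>w\<parallel>\<^sup>2\<close>.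
\<close>

lemma quasidense_bracket_small:
  fixes w :: "'f::real_normed_vector dual"
  assumes "0 < e"
  shows "\<exists>z. 1/2 * (norm z)\<^sup>2 + 1/2 * (norm w)\<^sup>2 + blinfun_apply w z \<le> e"
proof (cases "w = 0")
  case True
  then show ?thesis
    using assms by (intro exI[of _ 0]) simp
next
  case False
  then have w: "0 < norm w"
    by simp
  (* Multiplied by the length norm w of z, the defect e / norm w becomes exactly e. *)
  define b where "b = max 0 (norm w - e / norm w)"
  have "b < norm w"
    using w assms by (simp add: b_def)
  then obtain u where u: "b * norm u < \<bar>blinfun_apply w u\<bar>"
    using norm_blinfun_bound[of b w] unfolding b_def
    by (metis max.cobounded1 not_le real_norm_def)
  then have "0 < norm u"
    by auto
  define z where "z = (- sgn (blinfun_apply w u) * norm w / norm u) *\<^sub>R u"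
  have "blinfun_apply w u \<noteq> 0"
    using u by (auto simp: b_def max_def mult_less_0_iff split: if_splits)
  then have nz: "norm z = norm w"
    using \<open>0 < norm u\<close> by (simp add: z_def abs_mult abs_sgn_eq)
  have "blinfun_apply w z = - (norm w * (\<bar>blinfun_apply w u\<bar> / norm u))"
    by (simp add: z_def blinfun.scaleR_right blinfun.minus_right abs_sgn mult_ac)
  also have "\<dots> \<le> - (norm w * b)"
    using u w \<open>0 < norm u\<close> by (simp add: pos_le_divide_eq)
  also have "\<dots> \<le> - (norm w * (norm w - e / norm w))"
    using w by (simp add: b_def)
  also have "\<dots> = e - (norm w)\<^sup>2"
    using w by (simp add: field_simps power2_eq_square)
  finally have "1/2 * (norm z)\<^sup>2 + 1/2 * (norm w)\<^sup>2 + blinfun_apply w z \<le> e"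
    by (simp add: nz)
  then show ?thesis ..
qed

lemma quasidense_if_contains_slice:
  fixes A :: "('f::banach \<times> 'f dual) set"
  assumes "UNIV \<times> {t} \<subseteq> A"
  shows "quasidense A"
  unfolding quasidense_def
proof (intro allI)
  fix x :: 'f and x' :: "'f dual"
  let ?q = "\<lambda>(s, s'). ereal (1/2 * (norm (s - x))\<^sup>2 + 1/2 * (norm (s' - x'))\<^sup>2
                          + blinfun_apply (s' - x') (s - x))"
  show "Inf (?q ` A) \<le> 0"
  proof (rule ereal_le_epsilon2)
    fix e :: real
    assume "0 < e"
    then obtain z where "1/2 * (norm z)\<^sup>2 + 1/2 * (norm (t - x'))\<^sup>2 + blinfun_apply (t - x') z \<le> e"
      using quasidense_bracket_small by blast
    then have "?q (x + z, t) \<le> ereal e"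
      by simp
    moreover have "(x + z, t) \<in> A"
      using assms by auto
    ultimately show "Inf (?q ` A) \<le> 0 + ereal e"
      by (metis (no_types, lifting) INF_lower2 add_0)
  qed
qed

theorem lemma3p3:
  assumes "\<exists>e::'a::banach. e \<noteq> 0"
  shows "quasidense {(x', canonical_embedding x) | (x :: 'a) (x' :: 'a dual). True} \<and>
    (\<forall>(y' :: 'a dual) (y'' :: 'a dual dual).
      (INF (x :: 'a, x' :: 'a dual) \<in> UNIV.
         ereal (1/2 * (norm (y' - x'))\<^sup>2 + 1/2 * (norm (y'' - canonical_embedding x))\<^sup>2
                + blinfun_apply (y'' - canonical_embedding x) (y' - x'))) = 0)"
proof (intro conjI allI)
  let ?A = "{(x', canonical_embedding x) | (x :: 'a) (x' :: 'a dual). True}"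
  show qd: "quasidense ?A"
    by (rule quasidense_if_contains_slice[of "canonical_embedding 0"]) auto
  fix y' :: "'a dual" and y'' :: "'a dual dual"
  let ?q = "\<lambda>(s, s'). ereal (1/2 * (norm (s - y'))\<^sup>2 + 1/2 * (norm (s' - y''))\<^sup>2
                          + blinfun_apply (s' - y'') (s - y'))"
  let ?r = "\<lambda>(x, x'). ereal (1/2 * (norm (y' - x'))\<^sup>2
                + 1/2 * (norm (y'' - canonical_embedding x))\<^sup>2
                + blinfun_apply (y'' - canonical_embedding x) (y' - x'))"
  have A: "?A = (\<lambda>(x, x'). (x', canonical_embedding x)) ` UNIV"
    by auto
  have "?q (x', canonical_embedding x) = ?r (x, x')" for x x'
    by (simp add: norm_minus_commute blinfun.diff_left blinfun.diff_right)
  then have "?q ` ?A = range ?r"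
    unfolding A image_image by (intro image_cong) auto
  moreover have "Inf (?q ` ?A) \<le> 0"
    using qd unfolding quasidense_def by blast
  ultimately have "Inf (range ?r) \<le> 0"
    by simp
  moreover have "0 \<le> Inf (range ?r)"
    using quasidense_bracket_nonneg by (intro INF_greatest) (auto simp: zero_ereal_def)
  ultimately show "Inf (range ?r) = 0"
    by (rule antisym)
qed

end
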